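(* For each integer $n\ge 0$ let $\rho_{od}(n)$ denote the number of partitions of $n$ in which the largest part $\ell$ appears exactly once, the remaining parts are odd and pairwise distinct, and the remaining parts (all strictly smaller than $\ell$) form a partition of $\ell$ (the largest part $\ell$ itself may be even or odd). Then $$\sum_{n=0}^{\infty}\rho_{od}(n)q^n=(-q^2;q^4)_{\infty}-\frac{q^2}{1-q^4}-1.$$
   Context: A partition of a positive integer $n$ is a way of writing $n$ as a sum of positive integers (parts), listed in non-increasing order; the empty partition has no largest part and is not counted. For $|q|<1$, $(t;q)_0=1$, $(t;q)_n=(1-t)(1-tq)\cdots(1-tq^{n-1})$ for $n>0$, and $(t;q)_\infty=\lim_{n\to\infty}(t;q)_n$. *)

theory Defs
  imports Complex_Main "HOL-Library.Multiset"
begin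

text \<open>Partitions are multisets of parts, so that the order of the parts is immaterial.\<close>

definition partition_of :: "nat multiset \<Rightarrow> nat \<Rightarrow> bool" where
  "partition_of P n \<longleftrightarrow> (\<forall>x\<in>#P. x > 0) \<and> \<Sum>\<^sub># P = n"

text \<open>
  The empty partition has no largest part and is excluded explicitly, since
  \<^term>\<open>Max_mset {#}\<close> is unspecified. As the largest part has multiplicity one, all the
  remaining parts are strictly smaller than it.
\<close>

definition od_partition :: "nat multiset \<Rightarrow> bool" where
  "od_partition P \<longleftrightarrow> P \<noteq> {#} \<and>
     (let l = Max_mset P; R = P - {#l#} in
        count P l = 1 \<and>
        (\<forall>x\<in>#R. odd x \<and> count R x = 1) \<and>
        partition_of R l)"

definition rho_od :: "nat \<Rightarrow> nat" where
  "rho_od n = card {P. partition_of P n \<and> od_partition P}"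

definition qpoch :: "complex \<Rightarrow> complex \<Rightarrow> nat \<Rightarrow> complex" where
  "qpoch t q n = (\<Prod>k<n. 1 - t * q ^ k)"

definition qpoch_inf :: "complex \<Rightarrow> complex \<Rightarrow> complex" where
  "qpoch_inf t q = lim (qpoch t q)"

end

theory Submission
  imports Defs "HOL-Analysis.Infinite_Products" "HOL-Analysis.Infinite_Sum"
begin

text \<open>
  Removing the largest part \<open>l\<close> leaves a partition of \<open>l\<close> into distinct odd parts, so the
  whole partition has size \<open>2 * l\<close>; conversely every such partition of \<open>l\<close> arises, except
  the empty one and, for odd \<open>l\<close>, the one with the single part \<open>l\<close>. These exceptions
  contribute \<open>1\<close> and \<open>q\<^sup>2 / (1 - q\<^sup>4)\<close>. The partitions into distinct odd parts
  are generated by the product over odd \<open>a\<close> of \<open>1 + x ^ a\<close> at \<open>x = q\<^sup>2\<close>.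
\<close>

text \<open>Distinct parts let a set replace a multiset. \<open>Fpow\<close> matters because an
  infinite set would have the default sum 0.\<close>

definition distinct_partitions :: "nat set \<Rightarrow> nat \<Rightarrow> nat set set" where
  "distinct_partitions A n = {X \<in> Fpow A. \<Sum>X = n}"

lemma finite_distinct_partitions: "finite (distinct_partitions A n)"
proof (rule finite_subset)
  show "distinct_partitions A n \<subseteq> Pow {..n}"
    by (auto simp: distinct_partitions_def Fpow_def intro!: member_le_sum[where f = "\<lambda>x. x"])
qed simp

lemma prod_one_plus_power:
  fixes x :: "'a :: comm_semiring_1"
  assumes "finite B"
  shows "(\<Prod>a\<in>B. 1 + x ^ a) = (\<Sum>X\<in>Pow B. x ^ (\<Sum>X))"
  using prod_add[OF assms, of "\<lambda>a. x ^ a" "\<lambda>_. 1"] by (simp add: power_sum add.commute)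

text \<open>Any finite family \<open>F\<close> lies in the power set of its finite union, so its sum
  of norms is at most a finite product. Since 1 + t \<le> exp t, that product is bounded by the
  exponential of a geometric series, uniformly in \<open>F\<close>.\<close>

lemma abs_summable_on_Fpow_power:
  fixes x :: complex
  assumes "norm x < 1"
  shows "(\<lambda>X. x ^ (\<Sum>X)) abs_summable_on Fpow A"
proof (rule nonneg_bdd_above_summable_on)
  let ?r = "norm x"
  show "bdd_above (sum (\<lambda>X. norm (x ^ (\<Sum>X))) ` {F. F \<subseteq> Fpow A \<and> finite F})"
  proof (rule bdd_aboveI2)
    fix F assume "F \<in> {F. F \<subseteq> Fpow A \<and> finite F}"
    then have F: "F \<subseteq> Fpow A" "finite F" by auto
    have fin: "finite (\<Union>F)"
      using F by (auto simp: Fpow_def)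
    have "(\<Sum>X\<in>F. norm (x ^ (\<Sum>X))) \<le> (\<Sum>X\<in>Pow (\<Union>F). ?r ^ (\<Sum>X))"
      using fin by (auto simp: norm_power intro!: sum_mono2)
    also have "\<dots> = (\<Prod>a\<in>\<Union>F. 1 + ?r ^ a)"
      using fin by (simp add: prod_one_plus_power)
    also have "\<dots> \<le> exp (\<Sum>a\<in>\<Union>F. ?r ^ a)"
      by (intro prod_le_exp_sum) auto
    also have "(\<Sum>a\<in>\<Union>F. ?r ^ a) \<le> (\<Sum>a. ?r ^ a)"
      using assms fin by (intro sum_le_suminf summable_geometric) auto
    finally show "(\<Sum>X\<in>F. norm (x ^ (\<Sum>X))) \<le> exp (\<Sum>a. ?r ^ a)"
      by simp
  qed
qed simp

text \<open>One unordered sum over \<open>Fpow A\<close> is evaluated twice: grouping the sets by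
  their sum gives the power series, and exhausting \<open>Fpow A\<close> by finite power sets gives
  the product.\<close>

lemma distinct_partitions_generating_function:
  fixes x :: complex
  assumes "norm x < 1"
  obtains P where
    "(\<lambda>n. of_nat (card (distinct_partitions A n)) * x ^ n) sums P"
    "(\<lambda>n. \<Prod>a\<in>A \<inter> {..<n}. 1 + x ^ a) \<longlonglongrightarrow> P"
proof
  let ?f = "\<lambda>X. x ^ (\<Sum>X)"
  let ?P = "infsum ?f (Fpow A)"
  have sum: "(?f has_sum ?P) (Fpow A)"
    using abs_summable_summable[OF abs_summable_on_Fpow_power[OF assms]] by simp
  have "(?f has_sum ?P) (Fpow A) \<longleftrightarrow>
      ((\<lambda>(n, X). x ^ n) has_sum ?P) (Sigma UNIV (distinct_partitions A))"
    by (rule has_sum_reindex_bij_witness[where i = snd and j = "\<lambda>X. (\<Sum>X, X)"])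
       (auto simp: distinct_partitions_def)
  with sum have "((\<lambda>(n, X). x ^ n) has_sum ?P) (Sigma UNIV (distinct_partitions A))"
    by simp
  then have "((\<lambda>n. of_nat (card (distinct_partitions A n)) * x ^ n) has_sum ?P) UNIV"
    by (rule has_sum_SigmaD)
       (use finite_distinct_partitions in \<open>auto intro!: has_sum_finiteI\<close>)
  then show "(\<lambda>n. of_nat (card (distinct_partitions A n)) * x ^ n) sums ?P"
    by (rule has_sum_imp_sums)
  \<comment> \<open>These power sets eventually contain every finite family in
    \<open>Fpow A\<close>, so the sums over them, which are the partial products, converge to the
    unordered sum.\<close>
  have "filterlim (\<lambda>n. Pow (A \<inter> {..<n})) (finite_subsets_at_top (Fpow A)) sequentially"
    unfolding filterlim_finite_subsets_at_top
  proof safe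
    fix F assume F: "finite F" "F \<subseteq> Fpow A"
    then have "finite (\<Union>F)"
      by (auto simp: Fpow_def)
    then obtain N where "\<Union>F \<subseteq> {..<N}"
      using finite_nat_iff_bounded by blast
    have "F \<subseteq> Pow (A \<inter> {..<n})" if "N \<le> n" for n
    proof
      fix X assume "X \<in> F"
      then have "X \<subseteq> A" "X \<subseteq> {..<N}"
        using F(2) \<open>\<Union>F \<subseteq> {..<N}\<close> by (auto simp: Fpow_def)
      moreover have "{..<N} \<subseteq> {..<n}"
        using that by simp
      ultimately show "X \<in> Pow (A \<inter> {..<n})"
        by (metis Int_greatest PowI order_trans)
    qed
    moreover have "Pow (A \<inter> {..<n}) \<subseteq> Fpow A" for n
      by (auto simp: Fpow_def intro: finite_subset[of _ "A \<inter> {..<n}"])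
    ultimately show "\<forall>\<^sub>F n in sequentially. finite (Pow (A \<inter> {..<n})) \<and>
        F \<subseteq> Pow (A \<inter> {..<n}) \<and> Pow (A \<inter> {..<n}) \<subseteq> Fpow A"
      by (intro eventually_sequentiallyI[of N]) simp
  qed
  with sum have "(\<lambda>n. sum ?f (Pow (A \<inter> {..<n}))) \<longlonglongrightarrow> ?P"
    unfolding has_sum_def by (rule filterlim_compose)
  then show "(\<lambda>n. \<Prod>a\<in>A \<inter> {..<n}. 1 + x ^ a) \<longlonglongrightarrow> ?P"
    by (simp add: prod_one_plus_power)
qed

text \<open>The factor of index \<open>k\<close> belongs to the odd number \<open>2 * k + 1\<close>.
  Exactly \<open>n\<close> odd numbers lie below \<open>2 * n\<close>, so the partial q-products
  form a subsequence of the given products.\<close>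

lemma qpoch_inf_conv_prod_odd:
  fixes q :: complex
  assumes "(\<lambda>n. \<Prod>a\<in>{a. odd a} \<inter> {..<n}. 1 + (q ^ 2) ^ a) \<longlonglongrightarrow> P"
  shows "qpoch_inf (- (q ^ 2)) (q ^ 4) = P"
proof -
  have "(\<Prod>a\<in>{a. odd a} \<inter> {..<2 * n}. 1 + (q ^ 2) ^ a) = qpoch (- (q ^ 2)) (q ^ 4) n" for n
    unfolding qpoch_def
    by (rule prod.reindex_bij_witness[where i = "\<lambda>k. 2 * k + 1" and j = "\<lambda>a. a div 2"])
       (auto elim!: oddE simp flip: power_mult power_add)
  moreover have "(\<lambda>n. \<Prod>a\<in>{a. odd a} \<inter> {..<2 * n}. 1 + (q ^ 2) ^ a) \<longlonglongrightarrow> P"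
    using LIMSEQ_subseq_LIMSEQ[OF assms, of "\<lambda>n. 2 * n"] by (simp add: strict_mono_def o_def)
  ultimately show ?thesis
    unfolding qpoch_inf_def by (simp add: limI)
qed

lemma od_partitionE:
  assumes "od_partition P" "partition_of P n"
  obtains l X where "n = 2 * l" "l > 0" "P = add_mset l (mset_set X)"
    "X \<in> distinct_partitions {a. odd a} l - {{l}}"
proof
  define l where "l = Max_mset P"
  define R where "R = P - {#l#}"
  have l: "l \<in># P"
    using assms(1) by (simp add: od_partition_def l_def)
  have R: "count P l = 1" "\<And>x. x \<in># R \<Longrightarrow> odd x" "\<And>x. x \<in># R \<Longrightarrow> count R x = 1" "\<Sum>\<^sub># R = l"
    using assms(1) by (auto simp: od_partition_def partition_of_def Let_def l_def R_def)
  have P: "P = add_mset l R"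
    using l by (simp add: R_def)
  \<comment> \<open>As all multiplicities in \<open>R\<close> are one, passing to the set of parts
    loses nothing.\<close>
  have "R = mset_set (set_mset R)"
    using R(3) by (intro multiset_eqI) (auto simp: count_mset_set' not_in_iff)
  then have "\<Sum>(set_mset R) = l"
    using R(4) by (metis sum_unfold_sum_mset multiset.map_ident)
  moreover have "l \<notin># R"
    using R(1) P by (simp add: not_in_iff)
  ultimately show "set_mset R \<in> distinct_partitions {a. odd a} l - {{l}}"
    using R(2) by (auto simp: distinct_partitions_def Fpow_def)
  show "P = add_mset l (mset_set (set_mset R))"
    using P \<open>R = mset_set (set_mset R)\<close> by simp
  show "n = 2 * l" "l > 0"
    using assms(2) P R(4) by (auto simp: partition_of_def)
qed

lemma od_partitionI:
  assumes "l > 0" "X \<in> distinct_partitions {a. odd a} l - {{l}}"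
  shows "partition_of (add_mset l (mset_set X)) (2 * l)" "od_partition (add_mset l (mset_set X))"
proof -
  have X: "finite X" "\<And>x. x \<in> X \<Longrightarrow> odd x" "\<Sum>X = l" "X \<noteq> {l}"
    using assms(2) by (auto simp: distinct_partitions_def Fpow_def)
  have sum: "\<Sum>\<^sub># (mset_set X) = l"
    using X(3) by (simp add: sum_unfold_sum_mset)
  have le: "x \<le> l" if "x \<in> X" for x
    using member_le_sum[of x X "\<lambda>x. x"] X(1,3) that by simp
  \<comment> \<open>If \<open>l\<close> were in \<open>X\<close>, the other elements would sum to 0;
    being odd they cannot be 0, so \<open>X\<close> would be the excluded
    \<open>{l}\<close>.\<close>
  have "l \<notin> X"
  proof
    assume "l \<in> X"
    then have "\<Sum>(X - {l}) = 0"
      using X(1,3) by (simp add: sum_diff1_nat)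
    then have "\<forall>x\<in>X - {l}. x = 0"
      using X(1) by simp
    then have "x = l" if "x \<in> X" for x
      using X(2)[OF that] that by (metis DiffI even_zero singletonD)
    with \<open>l \<in> X\<close> have "X = {l}"
      by blast
    with X(4) show False ..
  qed
  moreover have "Max_mset (add_mset l (mset_set X)) = l"
    using le X(1) by (intro Max_eqI) auto
  ultimately show "od_partition (add_mset l (mset_set X))"
    using X(1,2) sum by (auto simp: od_partition_def partition_of_def odd_pos count_mset_set')
  show "partition_of (add_mset l (mset_set X)) (2 * l)"
    using assms(1) X(1,2) sum by (auto simp: partition_of_def odd_pos)
qed

lemma rho_od_double:
  assumes "l > 0"
  shows "rho_od (2 * l) = card (distinct_partitions {a. odd a} l - {{l}})"
proof -
  have "{P. partition_of P (2 * l) \<and> od_partition P} =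
      (\<lambda>X. add_mset l (mset_set X)) ` (distinct_partitions {a. odd a} l - {{l}})"
    using od_partitionI[OF assms] by (auto elim!: od_partitionE)
  moreover have "inj_on (\<lambda>X. add_mset l (mset_set X)) (distinct_partitions {a. odd a} l - {{l}})"
    by (auto simp: inj_on_def distinct_partitions_def Fpow_def mset_set_eq_iff)
  ultimately show ?thesis
    unfolding rho_od_def by (simp add: card_image)
qed

text \<open>This covers odd \<open>n\<close> and also \<open>n = 0\<close>.\<close>

lemma rho_od_eq_0:
  assumes "\<And>l. l > 0 \<Longrightarrow> n \<noteq> 2 * l"
  shows "rho_od n = 0"
proof -
  have "{P. partition_of P n \<and> od_partition P} = {}"
    using assms by (blast elim: od_partitionE)
  then show ?thesis
    by (metis rho_od_def card.empty)
qed

text \<open>Working in a ring keeps the corrections free of truncated subtraction: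
  \<open>{l}\<close> is removed for odd \<open>l\<close>, and the empty set for
  \<open>l = 0\<close>.\<close>

lemma of_nat_rho_od_double:
  "(of_nat (rho_od (2 * l)) :: 'a :: ring_1) = of_nat (card (distinct_partitions {a. odd a} l))
     - (if odd l then 1 else 0) - (if l = 0 then 1 else 0)"
proof (cases "l = 0")
  case True
  have "X = {}" if "X \<in> distinct_partitions {a. odd a} 0" for X
    using that by (fastforce simp: distinct_partitions_def Fpow_def)
  moreover have "{} \<in> distinct_partitions {a. odd a} 0"
    by (simp add: distinct_partitions_def Fpow_def)
  ultimately have "distinct_partitions {a. odd a} 0 = {{}}"
    by blast
  with True show ?thesis
    by (simp add: rho_od_eq_0)
next
  case False
  have "{l} \<in> distinct_partitions {a. odd a} l \<longleftrightarrow> odd l"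
    by (auto simp: distinct_partitions_def Fpow_def)
  \<comment> \<open>Positivity makes the natural-number subtraction of 1 exact under
    \<open>of_nat\<close>.\<close>
  moreover from this have "card (distinct_partitions {a. odd a} l) > 0" if "odd l"
    using that finite_distinct_partitions by (auto simp: card_gt_0_iff)
  ultimately show ?thesis
    using False by (auto simp: rho_od_double card_Diff_singleton_if of_nat_diff Suc_leI)
qed

theorem theorem4:
  fixes q :: complex
  assumes "norm q < 1"
  shows "(\<lambda>n. of_nat (rho_od n) * q ^ n) sums
           (qpoch_inf (- (q ^ 2)) (q ^ 4) - q ^ 2 / (1 - q ^ 4) - 1)"
proof -
  let ?x = "q ^ 2"
  let ?d = "\<lambda>l. card (distinct_partitions {a. odd a} l)"
  have "norm ?x < 1" "norm (q ^ 4) < 1"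
    using assms by (simp_all add: norm_power power_less_one_iff)
  obtain P where P: "(\<lambda>l. of_nat (?d l) * ?x ^ l) sums P"
      "(\<lambda>n. \<Prod>a\<in>{a. odd a} \<inter> {..<n}. 1 + ?x ^ a) \<longlonglongrightarrow> P"
    using distinct_partitions_generating_function[OF \<open>norm ?x < 1\<close>] by blast
  have "(\<lambda>k. ?x * (q ^ 4) ^ k) sums (?x * (1 / (1 - q ^ 4)))"
    by (intro sums_mult geometric_sums) fact
  \<comment> \<open>The always true test gives the terms the shape of a function of \<open>l\<close>
    at \<open>l = 2 * k + 1\<close>, as the reindexing to all \<open>l\<close> requires.\<close>
  then have "(\<lambda>k. if odd (2 * k + 1) then ?x ^ (2 * k + 1) else 0) sums (?x / (1 - q ^ 4))"
    by (simp flip: power_mult power_add)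
  then have odd: "(\<lambda>l. if odd l then ?x ^ l else 0) sums (?x / (1 - q ^ 4))"
    by (subst (asm) sums_mono_reindex[where g = "\<lambda>k. 2 * k + 1" and f = "\<lambda>l. if odd l then ?x ^ l else 0"])
       (auto simp: strict_mono_def elim!: oddE)
  have "(\<lambda>l. if l = 0 then ?x ^ l else 0) sums 1"
    using sums_single[of 0 "\<lambda>l. ?x ^ l"] by simp
  then have "(\<lambda>l. of_nat (?d l) * ?x ^ l - (if odd l then ?x ^ l else 0)
      - (if l = 0 then ?x ^ l else 0)) sums (P - ?x / (1 - q ^ 4) - 1)"
    by (intro sums_diff P odd)
  also have "(\<lambda>l. of_nat (?d l) * ?x ^ l - (if odd l then ?x ^ l else 0)
      - (if l = 0 then ?x ^ l else 0)) = (\<lambda>l. of_nat (rho_od (2 * l)) * q ^ (2 * l))"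
    by (rule ext) (simp add: of_nat_rho_od_double power_mult left_diff_distrib)
  \<comment> \<open>The indices outside the range of doubling are odd, and there
    \<open>rho_od\<close> vanishes.\<close>
  also have "\<dots> sums (P - ?x / (1 - q ^ 4) - 1) \<longleftrightarrow>
      (\<lambda>n. of_nat (rho_od n) * q ^ n) sums (P - ?x / (1 - q ^ 4) - 1)"
    by (rule sums_mono_reindex) (auto simp: strict_mono_def intro!: rho_od_eq_0)
  finally show ?thesis
    by (simp add: qpoch_inf_conv_prod_odd[OF P(2)])
qed

end
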